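(* Let $\mathbb{H}$ be a complex Hilbert space, let $T$ be a bounded linear operator on $\mathbb{H}$ and let $\lambda\in(0,1)$. Then $T$ is generalized hyperbolic if and only if its $\lambda$-Aluthge transform $\Delta_\lambda(T)$ is generalized hyperbolic. In particular (case $\lambda=\tfrac12$), $T$ is generalized hyperbolic if and only if its Aluthge transform $\Delta(T)$ is generalized hyperbolic.
   Context: - A bounded linear operator $T$ on a Banach space $X$ is generalized hyperbolic if it is invertible (with bounded inverse) and there is a direct sum decomposition $X=M\oplus N$ into complementary closed subspaces such that (i) $T(M)\subset M$ and $T^{-1}(N)\subset N$; (ii) the restrictions $T|_M:M\to M$ and $T^{-1}|_N:N\to N$ are uniform contractions, i.e. have spectral radius $<1$. - For $T\in B(\mathbb{H})$ let $T=U|T|$ be the polar decomposition, where $|T|=(T^*T)^{1/2}$ and $U$ is the unique partial isometry with $\ker U=\ker T=\ker|T|$. For $\lambda\in(0,1)$ the $\lambda$-Aluthge transform is $\Delta_\lambda(T)=|T|^{\lambda}U|T|^{1-\lambda}$, and the Aluthge transform is $\Delta(T)=\Delta_{1/2}(T)=|T|^{1/2}U|T|^{1/2}$. *)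

theory Defs
  imports "HOL-Analysis.Analysis" "HOL-Computational_Algebra.Polynomial"
begin

section \<open>Complex Banach and Hilbert spaces\<close>

class complex_normed_vector = real_normed_vector +
  fixes scaleC :: "complex \<Rightarrow> 'a \<Rightarrow> 'a"  (infixr "*\<^sub>C" 75)
  assumes scaleC_add_right: "c *\<^sub>C (x + y) = c *\<^sub>C x + c *\<^sub>C y"
    and scaleC_add_left: "(c + d) *\<^sub>C x = c *\<^sub>C x + d *\<^sub>C x"
    and scaleC_scaleC: "c *\<^sub>C (d *\<^sub>C x) = (c * d) *\<^sub>C x"
    and scaleC_of_real: "complex_of_real r *\<^sub>C x = r *\<^sub>R x"
    and norm_scaleC: "norm (c *\<^sub>C x) = cmod c * norm x"

class complex_banach = complex_normed_vector + banach

text \<open>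
  The inner product is linear in the first argument. The real inner product of the
  superclass is its real part, so that the norm is \<open>sqrt (Re (cinner x x))\<close> and positive
  definiteness is inherited.
\<close>

class complex_inner = complex_normed_vector + real_inner +
  fixes cinner :: "'a \<Rightarrow> 'a \<Rightarrow> complex"
  assumes cinner_commute: "cinner x y = cnj (cinner y x)"
    and cinner_add_left: "cinner (x + y) z = cinner x z + cinner y z"
    and cinner_scaleC_left: "cinner (c *\<^sub>C x) y = c * cinner x y"
    and inner_eq_Re_cinner: "inner x y = Re (cinner x y)"

class complex_hilbert = complex_inner + complex_banach

instantiation complex :: complex_hilbert
begin
definition "scaleC_complex = (\<lambda>c x::complex. c * x)"
definition "cinner_complex = (\<lambda>x y::complex. x * cnj y)"
instance
  by standard
    (simp_all add: scaleC_complex_def cinner_complex_def inner_complex_def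
      algebra_simps norm_mult scaleR_conv_of_real)
end

text \<open>
  The type \<open>'a \<Rightarrow>\<^sub>L 'a\<close> consists of the bounded real-linear operators; the bounded
  operators of a complex space are those which also satisfy the following predicate.
\<close>

definition complex_linear :: "('a::complex_normed_vector \<Rightarrow>\<^sub>L 'a) \<Rightarrow> bool" where
  "complex_linear T \<longleftrightarrow> (\<forall>c x. T (c *\<^sub>C x) = c *\<^sub>C T x)"

definition closed_csubspace :: "'a::complex_normed_vector set \<Rightarrow> bool" where
  "closed_csubspace M \<longleftrightarrow> subspace M \<and> (\<forall>c. \<forall>x\<in>M. c *\<^sub>C x \<in> M) \<and> closed M"


section \<open>Spectrum and generalized hyperbolicity\<close>

text \<open>
  The following notions are relative to a subspace \<open>M\<close>, mapped into itself by \<open>f\<close>,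
  and speak about the restriction \<open>f|M : M \<rightarrow> M\<close>. The inverse of a linear bijection is
  linear, so only its boundedness has to be required.
\<close>

definition boundedly_invertible_on ::
  "'a::complex_normed_vector set \<Rightarrow> ('a \<Rightarrow> 'a) \<Rightarrow> bool" where
  "boundedly_invertible_on M f \<longleftrightarrow>
     bij_betw f M M \<and> (\<exists>K. \<forall>y\<in>M. norm (inv_into M f y) \<le> K * norm y)"

definition spectrum_on :: "'a::complex_normed_vector set \<Rightarrow> ('a \<Rightarrow> 'a) \<Rightarrow> complex set" where
  "spectrum_on M f = {z. \<not> boundedly_invertible_on M (\<lambda>x. f x - z *\<^sub>C x)}"

text \<open>
  The element \<open>0\<close> is inserted for the case \<open>M = {0}\<close>, where the spectrum is empty
  and the spectral radius is \<open>0\<close>.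
\<close>

definition spectral_radius_on :: "'a::complex_normed_vector set \<Rightarrow> ('a \<Rightarrow> 'a) \<Rightarrow> real" where
  "spectral_radius_on M f = Sup (insert 0 (cmod ` spectrum_on M f))"

definition generalized_hyperbolic :: "('a::complex_banach \<Rightarrow>\<^sub>L 'a) \<Rightarrow> bool" where
  "generalized_hyperbolic T \<longleftrightarrow>
     boundedly_invertible_on UNIV T \<and>
     (\<exists>M N. closed_csubspace M \<and> closed_csubspace N \<and>
        M \<inter> N = {0} \<and> (\<forall>x. \<exists>m\<in>M. \<exists>n\<in>N. x = m + n) \<and>
        T ` M \<subseteq> M \<and> inv T ` N \<subseteq> N \<and>
        spectral_radius_on M T < 1 \<and> spectral_radius_on N (inv T) < 1)"


section \<open>Continuous functional calculus\<close>

definition cadjoint :: "('a::complex_hilbert \<Rightarrow>\<^sub>L 'a) \<Rightarrow> ('a \<Rightarrow>\<^sub>L 'a)" where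
  "cadjoint T = (THE S :: 'a \<Rightarrow>\<^sub>L 'a. \<forall>x y. cinner (T x) y = cinner x (S y))"

definition poly_op :: "real poly \<Rightarrow> ('a::complex_normed_vector \<Rightarrow>\<^sub>L 'a) \<Rightarrow> ('a \<Rightarrow>\<^sub>L 'a)" where
  "poly_op p A = (\<Sum>i\<le>degree p. coeff p i *\<^sub>R ((blinfun_compose A ^^ i) id_blinfun))"

text \<open>
  For a self-adjoint operator \<open>A\<close>, whose spectrum is a compact set of reals, and a real
  function \<open>f\<close> continuous on the spectrum, \<open>f(A)\<close> is the limit in operator norm of
  \<open>p\<^sub>n(A)\<close> for real polynomials \<open>p\<^sub>n\<close> converging to \<open>f\<close> uniformly on the spectrum.
\<close>

definition cfc :: "(real \<Rightarrow> real) \<Rightarrow> ('a::complex_hilbert \<Rightarrow>\<^sub>L 'a) \<Rightarrow> ('a \<Rightarrow>\<^sub>L 'a)" where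
  "cfc f A = (THE B. \<forall>p :: nat \<Rightarrow> real poly.
      uniform_limit {t. complex_of_real t \<in> spectrum_on UNIV A} (\<lambda>n. poly (p n)) f sequentially
      \<longrightarrow> (\<lambda>n. poly_op (p n) A) \<longlonglongrightarrow> B)"

text \<open>Intended for positive \<open>A\<close> and \<open>r > 0\<close>; note that \<open>0 powr r = 0\<close>.\<close>

definition op_powr :: "('a::complex_hilbert \<Rightarrow>\<^sub>L 'a) \<Rightarrow> real \<Rightarrow> ('a \<Rightarrow>\<^sub>L 'a)" where
  "op_powr A r = cfc (\<lambda>t. t powr r) A"


section \<open>Polar decomposition and Aluthge transforms\<close>

definition abs_op :: "('a::complex_hilbert \<Rightarrow>\<^sub>L 'a) \<Rightarrow> ('a \<Rightarrow>\<^sub>L 'a)" where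
  "abs_op T = op_powr (cadjoint T o\<^sub>L T) (1/2)"

definition ker_op :: "('a::complex_normed_vector \<Rightarrow>\<^sub>L 'a) \<Rightarrow> 'a set" where
  "ker_op T = {x. T x = 0}"

definition partial_isometry :: "('a::complex_hilbert \<Rightarrow>\<^sub>L 'a) \<Rightarrow> bool" where
  "partial_isometry U \<longleftrightarrow> complex_linear U \<and>
     (\<forall>x. (\<forall>y\<in>ker_op U. cinner x y = 0) \<longrightarrow> norm (U x) = norm x)"

definition polar_isometry :: "('a::complex_hilbert \<Rightarrow>\<^sub>L 'a) \<Rightarrow> ('a \<Rightarrow>\<^sub>L 'a)" where
  "polar_isometry T = (THE U. partial_isometry U \<and> T = U o\<^sub>L abs_op T \<and>
     ker_op U = ker_op T \<and> ker_op T = ker_op (abs_op T))"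

definition lambda_aluthge :: "real \<Rightarrow> ('a::complex_hilbert \<Rightarrow>\<^sub>L 'a) \<Rightarrow> ('a \<Rightarrow>\<^sub>L 'a)" where
  "lambda_aluthge l T = op_powr (abs_op T) l o\<^sub>L polar_isometry T o\<^sub>L op_powr (abs_op T) (1 - l)"

definition aluthge :: "('a::complex_hilbert \<Rightarrow>\<^sub>L 'a) \<Rightarrow> ('a \<Rightarrow>\<^sub>L 'a)" where
  "aluthge T = op_powr (abs_op T) (1/2) o\<^sub>L polar_isometry T o\<^sub>L op_powr (abs_op T) (1/2)"

lemma aluthge_eq_lambda_aluthge: "aluthge T = lambda_aluthge (1/2) T"
  by (simp add: aluthge_def lambda_aluthge_def)

end

theory Submission
  imports Defs "HOL-Computational_Algebra.Fundamental_Theorem_Algebra"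
begin

text \<open>
  If \<open>T\<close> is bounded below then \<open>|T|\<close> is invertible and \<open>\<Delta>\<^sub>l(T) = |T|\<^sup>l T (|T|\<^sup>l)\<^sup>-\<^sup>1\<close> is similar
  to \<open>T\<close>, and generalized hyperbolicity is invariant under similarity. An invertible \<open>T\<close> is
  bounded below; so is \<open>T\<close> if \<open>\<Delta>\<^sub>l(T)\<close> is invertible, because then \<open>|T|\<^sup>l\<close> has a bounded right
  inverse, hence is bounded below, and \<open>(|T|\<^sup>l)\<^sup>n = |T|\<^sup>n\<^sup>l\<^sup>-\<^sup>1 |T|\<close> for large \<open>n\<close>.
\<close>

text \<open>\<open>cadjoint\<close>, \<open>cfc\<close> and \<open>polar_isometry\<close> are
  definite descriptions, so each must be shown to describe something before it can be used. The
  adjoint comes from the Riesz theorem. The functional calculus rests on bounding the norm of p(A)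
  by the supremum of |p| over the real spectrum of A. This bound is reached through lower bounds
  alone: for self-adjoint A, a real t lies outside the spectrum exactly when A - t is bounded below,
  and lower bounds pass through the factorization of a real polynomial. The polar isometry is
  identified only when T is bounded below; in the remaining case the argument uses just that it is
  some bounded operator standing to the right of |T|^l. Most of the work takes place in the real
  inner product, and the complex structure returns as commutation with multiplication by i.\<close>

section \<open>Self-adjoint operators bounded below\<close>

text \<open>
  With respect to the real inner product; for complex-linear operators this is equivalent to
  self-adjointness with respect to \<open>cinner\<close>.
\<close>

definition selfadjoint :: "('a::real_inner \<Rightarrow>\<^sub>L 'a) \<Rightarrow> bool" where
  "selfadjoint S \<longleftrightarrow> (\<forall>x y. S x \<bullet> y = x \<bullet> S y)"

text \<open>For a self-adjoint operator on a complete space this amounts to invertibility, but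
  unlike invertibility it passes from a product to its right factor.\<close>

definition bounded_below :: "('a::real_normed_vector \<Rightarrow>\<^sub>L 'b::real_normed_vector) \<Rightarrow> bool" where
  "bounded_below S \<longleftrightarrow> (\<exists>c>0. \<forall>x. c * norm x \<le> norm (S x))"

lemma bounded_below_compose:
  assumes "bounded_below P" "bounded_below Q"
  shows "bounded_below (P o\<^sub>L Q)"
proof -
  obtain c d where cd: "c > 0" "\<And>x. c * norm x \<le> norm (P x)" "d > 0" "\<And>x. d * norm x \<le> norm (Q x)"
    using assms unfolding bounded_below_def by blast
  have "(c * d) * norm x \<le> norm ((P o\<^sub>L Q) x)" for x
  proof -
    have "(c * d) * norm x \<le> c * norm (Q x)"
      using cd(1,4) by (simp add: mult.assoc)
    also have "\<dots> \<le> norm ((P o\<^sub>L Q) x)"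
      using cd(2) by simp
    finally show ?thesis .
  qed
  moreover have "c * d > 0" using cd by simp
  ultimately show ?thesis unfolding bounded_below_def by blast
qed

lemma bounded_below_right_factor:
  assumes "bounded_below (P o\<^sub>L Q)"
  shows "bounded_below Q"
proof -
  obtain c where c: "c > 0" "\<And>x. c * norm x \<le> norm (P (Q x))"
    using assms unfolding bounded_below_def by auto
  \<comment> \<open>The summand 1 keeps the denominator positive when \<open>P = 0\<close>.\<close>
  have "c / (norm P + 1) * norm x \<le> norm (Q x)" for x
  proof -
    have "c * norm x \<le> norm P * norm (Q x)"
      using c(2) norm_blinfun order_trans by blast
    also have "\<dots> \<le> (norm P + 1) * norm (Q x)"
      by (simp add: mult_right_mono)
    finally have "c * norm x \<le> norm (Q x) * (norm P + 1)" by (simp only: mult.commute)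
    then show ?thesis
      using norm_ge_zero[of P] by (simp add: pos_divide_le_eq add_nonneg_pos)
  qed
  moreover have "c / (norm P + 1) > 0"
    using c(1) by (simp add: add_nonneg_pos)
  ultimately show ?thesis unfolding bounded_below_def by blast
qed

lemma bounded_below_inj: "bounded_below S \<Longrightarrow> inj (blinfun_apply S)"
proof (rule injI)
  fix x y assume "bounded_below S" and eq: "S x = S y"
  then obtain c where c: "c > 0" "\<And>x. c * norm x \<le> norm (S x)"
    unfolding bounded_below_def by blast
  show "x = y"
    using c(2)[of "x - y"] c(1) eq by (simp add: blinfun.diff_right mult_le_0_iff)
qed

text \<open>
  A solution of \<open>S (S x) = y\<close> is a fixed point of \<open>x \<mapsto> x - e (S (S x) - y)\<close>, a contraction
  for small \<open>e\<close> since \<open>\<langle>S\<^sup>2 x, x\<rangle> = \<parallel>S x\<parallel>\<^sup>2 \<ge> c\<^sup>2 \<parallel>x\<parallel>\<^sup>2\<close>.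
\<close>

lemma selfadjoint_bounded_below_bij:
  fixes S :: "'a::{real_inner, complete_space} \<Rightarrow>\<^sub>L 'a"
  assumes sa: "selfadjoint S" and bb: "bounded_below S"
  shows "bij (blinfun_apply S)"
proof -
  obtain c where c: "c > 0" "\<And>x. c * norm x \<le> norm (S x)"
    using bb unfolding bounded_below_def by blast
  \<comment> \<open>Adding \<open>c\<close> gives both \<open>K > 0\<close> and
    \<open>c \<le> K\<close>; the latter makes the radicand of \<open>r\<close> nonnegative.\<close>
  define K where "K = norm S + c"
  have K: "K > 0" "c \<le> K" using c by (auto simp: K_def add_nonneg_pos)
  have SK: "norm (S x) \<le> K * norm x" for x
    using norm_blinfun[of S x] c(1) by (simp add: K_def distrib_right add_increasing2)
  \<comment> \<open>This \<open>e\<close> minimises 1 - 2 e c^2 + e^2 K^4, the bound for the squared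
    contraction factor; the minimum is 1 - c^4 / K^4.\<close>
  define e where "e = c\<^sup>2 / K ^ 4"
  define r where "r = sqrt (1 - c ^ 4 / K ^ 4)"
  have "c ^ 4 / K ^ 4 \<le> 1" using c K by (simp add: power_mono)
  moreover have "c ^ 4 / K ^ 4 > 0" using c K by simp
  ultimately have r: "0 \<le> r" "r < 1" "r\<^sup>2 = 1 - c ^ 4 / K ^ 4"
    by (auto simp: r_def)
  have contr: "norm (x - e *\<^sub>R S (S x)) \<le> r * norm x" for x
  proof -
    have "norm (S (S x)) \<le> K\<^sup>2 * norm x"
      using order_trans[OF SK[of "S x"] mult_left_mono[OF SK[of x], of K]] K
      by (simp add: power2_eq_square mult.assoc)
    then have 1: "(norm (S (S x)))\<^sup>2 \<le> K ^ 4 * (norm x)\<^sup>2"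
      using power_mono[of "norm (S (S x))" "K\<^sup>2 * norm x" 2] by (simp add: power_mult_distrib)
    have 2: "c\<^sup>2 * (norm x)\<^sup>2 \<le> (norm (S x))\<^sup>2"
      using power_mono[OF c(2)[of x], of 2] c(1) by (simp add: power_mult_distrib)
    have "x \<bullet> S (S x) = (norm (S x))\<^sup>2"
      using sa by (metis selfadjoint_def power2_norm_eq_inner)
    then have "(norm (x - e *\<^sub>R S (S x)))\<^sup>2
        = (norm x)\<^sup>2 - 2 * e * (norm (S x))\<^sup>2 + e\<^sup>2 * (norm (S (S x)))\<^sup>2"
      unfolding power2_norm_eq_inner
      by (simp add: inner_diff_left inner_diff_right inner_commute power2_eq_square algebra_simps)
    also have "\<dots> \<le> (norm x)\<^sup>2 - 2 * e * (c\<^sup>2 * (norm x)\<^sup>2) + e\<^sup>2 * (K ^ 4 * (norm x)\<^sup>2)"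
      using 1 2 K by (intro add_mono diff_mono mult_left_mono) (auto simp: e_def)
    also have "\<dots> = (1 - 2 * (e * c\<^sup>2) + e\<^sup>2 * K ^ 4) * (norm x)\<^sup>2"
      by (simp add: algebra_simps)
    also have "\<dots> = (r * norm x)\<^sup>2"
    proof -
      have "e * c\<^sup>2 = c ^ 4 / K ^ 4"
        by (simp add: e_def power2_eq_square power4_eq_xxxx)
      moreover have "e\<^sup>2 * K ^ 4 = c ^ 4 / K ^ 4"
        using K by (simp add: e_def power2_eq_square power4_eq_xxxx)
      ultimately show ?thesis by (simp add: power_mult_distrib r(3))
    qed
    finally show ?thesis
      by (rule power2_le_imp_le) (use r(1) in simp)
  qed
  have "\<exists>x. S x = y" for y
  proof -
    define f where "f = (\<lambda>x. x - e *\<^sub>R (S (S x) - y))"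
    have "dist (f a) (f b) \<le> r * dist a b" for a b
    proof -
      have "f a - f b = (a - b) - e *\<^sub>R S (S (a - b))"
        by (simp add: f_def blinfun.diff_right algebra_simps)
      then show ?thesis using contr[of "a - b"] by (simp add: dist_norm)
    qed
    then obtain x where "f x = x"
      using banach_fix_type[of r f] r(1,2) by blast
    then have "S (S x) = y"
      using c(1) K(1) by (simp add: f_def e_def)
    then show ?thesis by blast
  qed
  then have "surj (blinfun_apply S)" unfolding surj_def by metis
  then show ?thesis using bounded_below_inj[OF bb] by (simp add: bij_def)
qed

lemma bounded_below_bij_inverse:
  assumes bb: "bounded_below S" and bij: "bij (blinfun_apply S)"
  obtains R where "R o\<^sub>L S = id_blinfun" "S o\<^sub>L R = id_blinfun"
proof -
  obtain c where c: "c > 0" "\<And>x. c * norm x \<le> norm (S x)"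
    using bb unfolding bounded_below_def by blast
  have SR: "S (inv S y) = y" for y using bij by (simp add: bij_is_surj surj_f_inv_f)
  have RS: "inv S (S x) = x" for x using bij by (simp add: bij_is_inj)
  have bl: "bounded_linear (inv S)"
  proof (rule bounded_linear_intro[where K = "1 / c"])
    show "inv S (x + y) = inv S x + inv S y" for x y
      by (metis RS SR blinfun.add_right)
    show "inv S (r *\<^sub>R x) = r *\<^sub>R inv S x" for r x
      by (metis RS SR blinfun.scaleR_right)
    show "norm (inv S x) \<le> norm x * (1 / c)" for x
      using c(2)[of "inv S x"] c(1) by (simp add: SR field_simps)
  qed
  show ?thesis
    by (rule that[of "Blinfun (inv S)"]; rule blinfun_eqI)
      (simp_all add: bounded_linear_Blinfun_apply[OF bl] SR RS)
qed

section \<open>Riesz representation and the real adjoint\<close>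

text \<open>The representing vector minimises \<open>x \<mapsto> \<parallel>x\<parallel>\<^sup>2 / 2 - f x\<close>.\<close>

theorem riesz_representation:
  fixes f :: "'a::{real_inner, complete_space} \<Rightarrow> real"
  assumes "bounded_linear f"
  obtains w where "\<And>x. f x = x \<bullet> w"
proof -
  interpret f: bounded_linear f by fact
  define J where "J = (\<lambda>x. (norm x)\<^sup>2 / 2 - f x)"
  obtain K where K: "\<And>x. norm (f x) \<le> norm x * K" using f.bounded by blast
  have lower: "- (K\<^sup>2 / 2) \<le> J x" for x
    using K[of x] sum_power2_ge_zero[of "norm x - K" 0]
    by (simp add: J_def power2_eq_square algebra_simps abs_le_iff)
  then have bdd: "bdd_below (range J)" by (auto simp: bdd_below_def)
  define d where "d = Inf (range J)"
  have dJ: "d \<le> J x" for x unfolding d_def using bdd by (simp add: cInf_lower)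
  have "\<exists>x. J x < d + inverse (Suc n)" for n
    using cInf_lessD[of "range J" "d + inverse (Suc n)"] by (auto simp: d_def)
  then obtain X where X: "\<And>n. J (X n) < d + inverse (Suc n)" by metis
  \<comment> \<open>The parallelogram law, in which the linear terms of \<open>J\<close> cancel:
    since \<open>J\<close> is at least \<open>d\<close> at the midpoint, two near-minimisers must be
    close.\<close>
  have par: "(norm (x - y))\<^sup>2 / 4 = J x + J y - 2 * J ((1/2) *\<^sub>R (x + y))" for x y
    unfolding J_def power2_norm_eq_inner
    by (simp add: f.scaleR f.add inner_add inner_diff inner_commute field_simps)
  have dist: "(norm (X m - X n))\<^sup>2 < 4 * (inverse (Suc m) + inverse (Suc n))" for m n
    using par[of "X m" "X n"] X[of m] X[of n] dJ[of "(1/2) *\<^sub>R (X m + X n)"] by argo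
  have "Cauchy X"
  proof (rule metric_CauchyI)
    fix e :: real assume e: "e > 0"
    then obtain N where N: "inverse (Suc N) < e\<^sup>2 / 8"
      using reals_Archimedean[of "e\<^sup>2 / 8"] by auto
    have "dist (X m) (X n) < e" if "m \<ge> N" "n \<ge> N" for m n
    proof -
      have "inverse (Suc m) \<le> inverse (Suc N)" "inverse (Suc n) \<le> inverse (Suc N)"
        using that by (auto intro!: le_imp_inverse_le)
      then have "(norm (X m - X n))\<^sup>2 < e\<^sup>2"
        using N dist[of m n] by argo
      then show ?thesis using e by (simp add: dist_norm power2_less_imp_less)
    qed
    then show "\<exists>M. \<forall>m\<ge>M. \<forall>n\<ge>M. dist (X m) (X n) < e" by blast
  qed
  then obtain w where w: "X \<longlonglongrightarrow> w" using Cauchy_convergent_iff convergent_def by blast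
  have "(\<lambda>n. J (X n)) \<longlonglongrightarrow> J w"
    unfolding J_def by (intro tendsto_intros w f.tendsto) auto
  moreover have "(\<lambda>n. d + inverse (Suc n)) \<longlonglongrightarrow> d + 0"
    by (intro tendsto_intros LIMSEQ_inverse_real_of_nat)
  ultimately have "J w \<le> d"
    using X by (simp add: LIMSEQ_le less_imp_le)
  then have min: "J w \<le> J y" for y using dJ order_trans by blast
  have "f x = x \<bullet> w" for x
  proof (rule ccontr)
    assume ne: "f x \<noteq> x \<bullet> w"
    define a where "a = f x - x \<bullet> w"
    \<comment> \<open>Along \<open>x\<close> the functional changes by at most - t a + t^2 N / 2,
      which is least at t = a / N with value - a^2 / (2 N). The summand 1 makes \<open>N\<close>
      positive.\<close>
    define N where "N = (norm x)\<^sup>2 + 1"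
    have N: "N > 0" "(norm x)\<^sup>2 \<le> N" by (auto simp: N_def add_nonneg_pos)
    have "J (w + t *\<^sub>R x) = J w - t * a + t\<^sup>2 * (norm x)\<^sup>2 / 2" for t
      unfolding J_def a_def power2_norm_eq_inner
      by (simp add: f.scaleR f.add inner_add inner_commute field_simps power2_eq_square)
    then have "0 \<le> - ((a / N) * a) + (a / N)\<^sup>2 * (norm x)\<^sup>2 / 2"
      using min[of "w + (a / N) *\<^sub>R x"] by simp
    also have "\<dots> \<le> - ((a / N) * a) + (a / N)\<^sup>2 * N / 2"
      using N by (intro add_left_mono divide_right_mono mult_left_mono) auto
    also have "\<dots> = - (a\<^sup>2 / (2 * N))"
      using N by (simp add: field_simps power2_eq_square)
    also have "\<dots> < 0" using ne N by (simp add: a_def)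
    finally show False by simp
  qed
  then show ?thesis using that by blast
qed

lemma real_adjoint_exists:
  fixes T :: "'a::{real_inner, complete_space} \<Rightarrow>\<^sub>L 'b::real_inner"
  obtains S :: "'b \<Rightarrow>\<^sub>L 'a" where "\<And>x y. T x \<bullet> y = x \<bullet> S y"
proof -
  have "\<exists>w. \<forall>x. T x \<bullet> y = x \<bullet> w" for y
  proof -
    have "bounded_linear (\<lambda>x. T x \<bullet> y)"
      by (intro bounded_linear_intros)
    then show ?thesis by (metis riesz_representation)
  qed
  then obtain g where g: "\<And>x y. T x \<bullet> y = x \<bullet> g y" by metis
  have "bounded_linear g"
  proof (rule bounded_linear_intro[where K = "norm T"])
    show "g (y + z) = g y + g z" for y z
      by (rule vector_eq_rdot[THEN iffD1]) (simp add: inner_add inner_commute flip: g)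
    show "g (r *\<^sub>R y) = r *\<^sub>R g y" for r y
      by (rule vector_eq_rdot[THEN iffD1]) (simp add: inner_commute flip: g)
    show "norm (g y) \<le> norm y * norm T" for y
    proof (cases "g y = 0")
      case False
      have "norm (g y) * norm (g y) = T (g y) \<bullet> y"
        by (simp add: g power2_norm_eq_inner flip: power2_eq_square)
      also have "\<dots> \<le> norm (T (g y)) * norm y" by (rule norm_cauchy_schwarz)
      also have "\<dots> \<le> (norm T * norm (g y)) * norm y"
        by (intro mult_right_mono norm_blinfun) auto
      finally show ?thesis using False by (simp add: mult.commute mult.left_commute)
    qed (simp)
  qed
  then show ?thesis using that[of "Blinfun g"] g by (simp add: bounded_linear_Blinfun_apply)
qed

section \<open>Polynomials of self-adjoint operators\<close>

lemma poly_op_altdef: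
  assumes "degree p \<le> n"
  shows "poly_op p A = (\<Sum>i\<le>n. coeff p i *\<^sub>R ((blinfun_compose A ^^ i) id_blinfun))"
  unfolding poly_op_def
  by (rule sum.mono_neutral_left) (use assms in \<open>auto simp: coeff_eq_0\<close>)

lemma poly_op_0 [simp]: "poly_op 0 A = 0"
  by (simp add: poly_op_def)

lemma poly_op_add: "poly_op (p + q) A = poly_op p A + poly_op q A"
proof -
  define n where "n = max (degree p) (degree q)"
  have "degree (p + q) \<le> n" "degree p \<le> n" "degree q \<le> n"
    by (auto simp: n_def degree_add_le_max)
  then show ?thesis
    by (simp add: poly_op_altdef[of _ n] scaleR_add_left sum.distrib)
qed

lemma poly_op_smult: "poly_op (smult c p) A = c *\<^sub>R poly_op p A"
  by (simp add: poly_op_altdef[of _ "degree p"] degree_smult_le scaleR_sum_right)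

lemma poly_op_diff: "poly_op (p - q) A = poly_op p A - poly_op q A"
  using poly_op_add[of p "smult (-1) q" A] poly_op_smult[of "-1" q A] by simp

lemma poly_op_pCons: "poly_op (pCons a p) A = a *\<^sub>R id_blinfun + (A o\<^sub>L poly_op p A)"
proof -
  have "poly_op (pCons a p) A
      = (\<Sum>i\<le>Suc (degree p). coeff (pCons a p) i *\<^sub>R ((blinfun_compose A ^^ i) id_blinfun))"
    by (rule poly_op_altdef) (simp add: degree_pCons_le)
  also have "\<dots> = a *\<^sub>R id_blinfun + (A o\<^sub>L poly_op p A)"
    by (subst sum.atMost_Suc_shift, rule blinfun_eqI)
      (simp add: poly_op_def blinfun.bilinear_simps blinfun.sum_left blinfun.sum_right)
  finally show ?thesis .
qed

lemma poly_op_mult: "poly_op (p * q) A = poly_op p A o\<^sub>L poly_op q A"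
proof (induction p)
  case 0
  show ?case by (rule blinfun_eqI) simp
next
  case (pCons a p)
  show ?case
    by (rule blinfun_eqI)
      (simp add: pCons.IH poly_op_add poly_op_smult poly_op_pCons blinfun.bilinear_simps)
qed

lemma selfadjoint_poly_op:
  assumes "selfadjoint A"
  shows "selfadjoint (poly_op p A)"
proof (induction p)
  case 0
  show ?case by (simp add: selfadjoint_def)
next
  case (pCons a p)
  \<comment> \<open>A product of self-adjoint operators is self-adjoint when the factors commute;
    here this comes from commutativity of polynomial multiplication.\<close>
  have comm: "A (poly_op p A x) = poly_op p A (A x)" for x
    using poly_op_mult[of "[:0, 1:]" p A] poly_op_mult[of p "[:0, 1:]" A]
    by (auto simp: poly_op_pCons mult.commute dest: arg_cong[where f = "\<lambda>S. blinfun_apply S x"])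
  show ?case
    using assms pCons.IH comm
    by (simp add: selfadjoint_def poly_op_pCons blinfun.bilinear_simps inner_add)
qed

lemma complex_linear_poly_op:
  assumes "complex_linear A"
  shows "complex_linear (poly_op p A)"
proof (induction p)
  case 0
  have "c *\<^sub>C (0::'a) = 0" for c
    by (metis add.right_neutral add_left_cancel scaleC_add_right)
  then show ?case by (simp add: complex_linear_def)
next
  case (pCons a p)
  have "a *\<^sub>R c *\<^sub>C x = c *\<^sub>C a *\<^sub>R x" for c and x :: 'a
    by (metis scaleC_of_real scaleC_scaleC mult.commute)
  then show ?case
    using assms pCons.IH
    by (simp add: complex_linear_def poly_op_pCons blinfun.bilinear_simps scaleC_add_right)
qed

section \<open>Lower bounds for polynomials of a self-adjoint operator\<close>

definition op_shift :: "('a::real_normed_vector \<Rightarrow>\<^sub>L 'a) \<Rightarrow> real \<Rightarrow> ('a \<Rightarrow>\<^sub>L 'a)" where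
  "op_shift A t = A - t *\<^sub>R id_blinfun"

lemma op_shift_apply [simp]: "op_shift A t x = A x - t *\<^sub>R x"
  by (simp add: op_shift_def blinfun.bilinear_simps)

lemma selfadjoint_op_shift: "selfadjoint A \<Longrightarrow> selfadjoint (op_shift A t)"
  by (simp add: selfadjoint_def inner_diff)

lemma poly_op_linear: "poly_op [:- t, 1:] A = op_shift A t"
  by (rule blinfun_eqI) (simp add: poly_op_pCons blinfun.bilinear_simps)

text \<open>\<open>\<langle>((A - a)\<^sup>2 + b\<^sup>2) x, x\<rangle> = \<parallel>(A - a) x\<parallel>\<^sup>2 + b\<^sup>2 \<parallel>x\<parallel>\<^sup>2\<close>\<close>

lemma bounded_below_quadratic:
  assumes sa: "selfadjoint A" and "b \<noteq> 0"
  shows "bounded_below (poly_op [:a\<^sup>2 + b\<^sup>2, - 2 * a, 1:] A)"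
proof -
  let ?S = "op_shift A a" and ?Q = "poly_op [:a\<^sup>2 + b\<^sup>2, - 2 * a, 1:] A"
  have "[:a\<^sup>2 + b\<^sup>2, - 2 * a, 1:] = [:- a, 1:] * [:- a, 1:] + [:b\<^sup>2:]"
    by (simp add: power2_eq_square)
  then have Q: "?Q x = ?S (?S x) + b\<^sup>2 *\<^sub>R x" for x
    by (simp only: poly_op_add poly_op_mult poly_op_linear)
      (simp add: poly_op_pCons blinfun.bilinear_simps)
  have "b\<^sup>2 * norm x \<le> norm (?Q x)" for x
  proof (cases "x = 0")
    case False
    have "?S (?S x) \<bullet> x = ?S x \<bullet> ?S x"
      using selfadjoint_op_shift[OF sa, of a] unfolding selfadjoint_def by blast
    then have "?Q x \<bullet> x = ?S x \<bullet> ?S x + b\<^sup>2 * (x \<bullet> x)"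
      unfolding Q by (simp only: inner_add_left inner_scaleR_left)
    then have "b\<^sup>2 * (norm x * norm x) \<le> ?Q x \<bullet> x"
      by (simp add: power2_norm_eq_inner flip: power2_eq_square)
    also have "\<dots> \<le> norm (?Q x) * norm x" by (rule norm_cauchy_schwarz)
    finally show ?thesis using False by (simp flip: mult.assoc)
  qed simp
  moreover have "b\<^sup>2 > 0" using assms by simp
  ultimately show ?thesis unfolding bounded_below_def by blast
qed

text \<open>By the fundamental theorem of algebra there is a complex root z. A real z gives the
  linear factor; otherwise z = a + b i, and the quadratic is the product of X - z and X - cnj
  z.\<close>

lemma real_poly_factor_cases:
  fixes q :: "real poly"
  assumes "degree q > 0"
  obtains t r where "q = [:- t, 1:] * r" "poly q t = 0"
  | a b r where "b \<noteq> 0" "q = [:a\<^sup>2 + b\<^sup>2, - 2 * a, 1:] * r"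
proof -
  let ?c = "map_poly complex_of_real"
  have cmult: "?c (p * r) = ?c p * ?c r" for p r
    by (rule poly_eqI) (simp add: coeff_map_poly coeff_mult)
  have cadd: "?c (p + r) = ?c p + ?c r" for p r
    by (rule poly_eqI) (simp add: coeff_map_poly)
  have "degree (?c q) > 0" using assms by (simp add: degree_map_poly)
  then have "\<not> constant (poly (?c q))" by (simp add: constant_degree)
  then obtain z where z: "poly (?c q) z = 0" using fundamental_theorem_of_algebra by blast
  show ?thesis
  proof (cases "Im z = 0")
    case True
    have "poly (?c q) (of_real x) = of_real (poly q x)" for x
      by (induction q) (auto simp: map_poly_pCons)
    moreover have "of_real (Re z) = z" using True by (simp add: complex_eq_iff)
    ultimately have "complex_of_real (poly q (Re z)) = 0"
      using z by metis
    then have "poly q (Re z) = 0" by simp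
    then show ?thesis using that(1) by (auto simp: poly_eq_0_iff_dvd elim!: dvdE)
  next
    case False
    define d where "d = [:(Re z)\<^sup>2 + (Im z)\<^sup>2, - 2 * Re z, 1:]"
    \<comment> \<open>The remainder is real, has degree at most one and vanishes at the non-real
      \<open>z\<close>, so it is zero.\<close>
    define m where "m = q mod d"
    have d: "d \<noteq> 0" "degree d = 2" by (auto simp: d_def)
    have dz: "poly (?c d) z = 0"
      by (simp add: d_def map_poly_pCons complex_eq_iff power2_eq_square algebra_simps)
    have "q = d * (q div d) + m" by (simp add: m_def)
    then have "poly (?c m) z = 0"
      using z dz by (metis cadd cmult add.left_neutral mult_zero_left poly_add poly_mult)
    moreover have "degree m < 2"
      using degree_mod_less'[of d q] d unfolding m_def by fastforce
    then obtain u v where m: "m = [:u, v:]"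
      by (metis degree_eq_zeroE less_2_cases_iff degree_pCons_eq_if nat.inject One_nat_def pCons_cases pCons_0_0 degree_0)
    ultimately have "of_real u + z * of_real v = 0"
      by (simp add: map_poly_pCons)
    then have "v = 0" "u = 0" using False by (auto simp: complex_eq_iff)
    then have "q = d * (q div d)" using \<open>q = d * (q div d) + m\<close> m by simp
    then show ?thesis using that(2) False unfolding d_def by blast
  qed
qed

text \<open>The part of spectral mapping used later: a failure of the lower bound for q(A) is traced
  to a real root of \<open>q\<close> in the spectrum. Quadratic factors without real roots are
  harmless by self-adjointness.\<close>

lemma bounded_below_poly_op:
  assumes sa: "selfadjoint A"
  shows "q \<noteq> 0 \<Longrightarrow> (\<And>t. poly q t = 0 \<Longrightarrow> bounded_below (op_shift A t)) \<Longrightarrow> bounded_below (poly_op q A)"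
proof (induction "degree q" arbitrary: q rule: less_induct)
  case less
  show ?case
  proof (cases "degree q = 0")
    case True
    then obtain c where "q = [:c:]" by (rule degree_eq_zeroE)
    then show ?thesis
      using less.prems(1)
      by (auto simp: bounded_below_def poly_op_pCons blinfun.bilinear_simps intro!: exI[of _ "\<bar>c\<bar>"])
  next
    case False
    then have "degree q > 0" by simp
    then show ?thesis
    proof (cases rule: real_poly_factor_cases)
      case (1 t r)
      then have "r \<noteq> 0" using less.prems(1) by auto
      then have "degree r < degree q" unfolding 1(1) by (subst degree_mult_eq) auto
      then have "bounded_below (poly_op r A)"
        using less.hyps[of r] \<open>r \<noteq> 0\<close> less.prems(2) 1(1) by simp
      moreover have "bounded_below (poly_op [:- t, 1:] A)"
        using less.prems(2)[OF 1(2)] by (simp only: poly_op_linear)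
      ultimately show ?thesis
        unfolding 1(1) poly_op_mult by (intro bounded_below_compose)
    next
      case (2 a b r)
      then have "r \<noteq> 0" using less.prems(1) by auto
      then have "degree r < degree q" unfolding 2(2) by (subst degree_mult_eq) auto
      then have "bounded_below (poly_op r A)"
        using less.hyps[of r] \<open>r \<noteq> 0\<close> less.prems(2) 2(2) by simp
      then show ?thesis
        unfolding 2(2) poly_op_mult using bounded_below_quadratic[OF sa 2(1)]
        by (intro bounded_below_compose)
    qed
  qed
qed

text \<open>With m the norm of S, the squared norm of (S^2 - m^2) x is at most m^2 (m^2 |x|^2 - |S
  x|^2), which is small when x almost attains the norm. A lower bound c would improve the bound on
  |S x|^2 to (m^2 - c^2 / m^2) |x|^2, contradicting the choice of m. The vector \<open>z\<close>
  excludes the zero space, where every operator is bounded below.\<close>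

lemma selfadjoint_norm_not_bounded_below:
  fixes S :: "'a::real_inner \<Rightarrow>\<^sub>L 'a"
  assumes sa: "selfadjoint S" and nz: "(z::'a) \<noteq> 0"
  shows "\<not> bounded_below ((S o\<^sub>L S) - (norm S)\<^sup>2 *\<^sub>R id_blinfun)"
proof
  define m where "m = norm S"
  assume "bounded_below ((S o\<^sub>L S) - (norm S)\<^sup>2 *\<^sub>R id_blinfun)"
  then obtain c where c: "c > 0" "\<And>x. c * norm x \<le> norm (S (S x) - m\<^sup>2 *\<^sub>R x)"
    unfolding bounded_below_def m_def by (auto simp: blinfun.bilinear_simps)
  have Sm: "norm (S x) \<le> m * norm x" for x unfolding m_def by (rule norm_blinfun)
  have ineq: "c\<^sup>2 * (norm x)\<^sup>2 \<le> m\<^sup>2 * (m\<^sup>2 * (norm x)\<^sup>2 - (norm (S x))\<^sup>2)" for x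
  proof -
    have "c\<^sup>2 * (norm x)\<^sup>2 \<le> (norm (S (S x) - m\<^sup>2 *\<^sub>R x))\<^sup>2"
      using power_mono[OF c(2)[of x], of 2] c(1) by (simp add: power_mult_distrib)
    also have "\<dots> = (norm (S (S x)))\<^sup>2 - 2 * m\<^sup>2 * (S (S x) \<bullet> x) + m ^ 4 * (norm x)\<^sup>2"
      unfolding power2_norm_eq_inner
      by (simp add: inner_diff inner_commute power2_eq_square power4_eq_xxxx algebra_simps)
    also have "S (S x) \<bullet> x = (norm (S x))\<^sup>2"
      using sa by (simp add: selfadjoint_def power2_norm_eq_inner)
    also have "(norm (S (S x)))\<^sup>2 \<le> m\<^sup>2 * (norm (S x))\<^sup>2"
      using power_mono[OF Sm[of "S x"], of 2] by (simp add: power_mult_distrib)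
    finally show ?thesis by (simp add: algebra_simps power2_eq_square power4_eq_xxxx)
  qed
  have "m \<noteq> 0"
  proof
    assume "m = 0"
    then have "c\<^sup>2 * (norm z)\<^sup>2 \<le> 0" using ineq[of z] by simp
    moreover have "c\<^sup>2 * (norm z)\<^sup>2 > 0" using c(1) nz by simp
    ultimately show False by linarith
  qed
  then have m: "m > 0" by (simp add: m_def)
  define k where "k = m\<^sup>2 - c\<^sup>2 / m\<^sup>2"
  have k: "(norm (S x))\<^sup>2 \<le> k * (norm x)\<^sup>2" for x
    using ineq[of x] m by (simp add: k_def field_simps)
  have "0 \<le> k * (norm z)\<^sup>2" using k[of z] order_trans zero_le_power2 by blast
  then have k0: "k \<ge> 0" using nz by (simp add: zero_le_mult_iff)
  have "norm (S x) \<le> sqrt k * norm x" for x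
    using real_sqrt_le_mono[OF k[of x]] by (simp add: real_sqrt_mult)
  then have "m \<le> sqrt k" unfolding m_def using k0 by (intro norm_blinfun_bound) auto
  then have "m\<^sup>2 \<le> k" using m k0 power_mono[of m "sqrt k" 2] by simp
  moreover have "c\<^sup>2 / m\<^sup>2 > 0" using c(1) m by simp
  ultimately show False by (simp add: k_def)
qed

section \<open>The real spectrum and norms of polynomials\<close>

definition real_spectrum :: "('a::complex_hilbert \<Rightarrow>\<^sub>L 'a) \<Rightarrow> real set" where
  "real_spectrum A = {t. complex_of_real t \<in> spectrum_on UNIV A}"

lemma boundedly_invertible_of_bounded_below:
  fixes S :: "'a::complex_normed_vector \<Rightarrow>\<^sub>L 'a"
  assumes bb: "bounded_below S" and bij: "bij (blinfun_apply S)"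
  shows "boundedly_invertible_on UNIV (blinfun_apply S)"
proof -
  obtain R where R: "R o\<^sub>L S = id_blinfun" "S o\<^sub>L R = id_blinfun"
    using bounded_below_bij_inverse[OF assms] .
  have "inv S y = R y" for y
    by (metis R(2) bij bij_is_inj blinfun_apply_blinfun_compose id_blinfun.rep_eq inv_f_f id_apply)
  then show ?thesis
    using bij norm_blinfun[of R] unfolding boundedly_invertible_on_def by auto
qed

lemma bounded_below_of_boundedly_invertible:
  fixes S :: "'a::complex_normed_vector \<Rightarrow>\<^sub>L 'a"
  assumes "boundedly_invertible_on UNIV (blinfun_apply S)"
  shows "bounded_below S"
proof -
  obtain K where K: "\<And>y. norm (inv S y) \<le> K * norm y" and inj: "inj S"
    using assms unfolding boundedly_invertible_on_def bij_def by blast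
  have "1 / (\<bar>K\<bar> + 1) * norm x \<le> norm (S x)" for x
  proof -
    have "norm x \<le> K * norm (S x)"
      using K[of "S x"] unfolding inv_f_f[OF inj] .
    also have "\<dots> \<le> (\<bar>K\<bar> + 1) * norm (S x)"
      by (intro mult_right_mono) auto
    finally have "norm x \<le> norm (S x) * (\<bar>K\<bar> + 1)"
      by (simp only: mult.commute)
    then show ?thesis
      by (simp add: pos_divide_le_eq add_nonneg_pos)
  qed
  then show ?thesis unfolding bounded_below_def
    by (intro exI[of _ "1 / (\<bar>K\<bar> + 1)"]) (auto simp: add_nonneg_pos)
qed

text \<open>For real t the shift A - t is again self-adjoint, so a lower bound already yields
  bijectivity.\<close>

lemma real_spectrum_iff:
  assumes "selfadjoint A"
  shows "t \<in> real_spectrum A \<longleftrightarrow> \<not> bounded_below (op_shift A t)"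
proof -
  have eq: "(\<lambda>x. A x - complex_of_real t *\<^sub>C x) = blinfun_apply (op_shift A t)"
    by (simp add: fun_eq_iff scaleC_of_real)
  show ?thesis
    using assms unfolding real_spectrum_def spectrum_on_def mem_Collect_eq eq
    by (metis bounded_below_of_boundedly_invertible boundedly_invertible_of_bounded_below
        selfadjoint_bounded_below_bij selfadjoint_op_shift)
qed

text \<open>
  With \<open>m = \<parallel>p(A)\<parallel>\<close>, the operator \<open>p(A)\<^sup>2 - m\<^sup>2\<close> is not bounded below, so the polynomial
  \<open>p\<^sup>2 - m\<^sup>2\<close> vanishes at a point of the spectrum of \<open>A\<close>.
\<close>

lemma norm_poly_op_attained:
  fixes A :: "'a::complex_hilbert \<Rightarrow>\<^sub>L 'a"
  assumes sa: "selfadjoint A" and nz: "(z::'a) \<noteq> 0"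
  shows "\<exists>t\<in>real_spectrum A. norm (poly_op p A) = \<bar>poly p t\<bar>"
proof -
  have main: "\<exists>t\<in>real_spectrum A. poly (p * p - [:(norm (poly_op p A))\<^sup>2:]) t = 0"
    if "p * p - [:(norm (poly_op p A))\<^sup>2:] \<noteq> 0" for p
  proof -
    let ?q = "p * p - [:(norm (poly_op p A))\<^sup>2:]"
    have "poly_op ?q A
        = (poly_op p A o\<^sub>L poly_op p A) - (norm (poly_op p A))\<^sup>2 *\<^sub>R id_blinfun"
      by (rule blinfun_eqI) (simp add: poly_op_diff poly_op_mult poly_op_pCons blinfun.bilinear_simps)
    then have "\<not> bounded_below (poly_op ?q A)"
      using selfadjoint_norm_not_bounded_below[OF selfadjoint_poly_op[OF sa] nz] by metis
    then show ?thesis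
      using bounded_below_poly_op[OF sa that] real_spectrum_iff[OF sa] by blast
  qed
  \<comment> \<open>Taking X for \<open>p\<close> shows that the spectrum is nonempty. Its point
    \<open>s\<close> serves the degenerate case in which p^2 - m^2 is the zero polynomial.\<close>
  have "[:0, 1:] * [:0, 1:] - [:c:] \<noteq> 0" for c :: real by simp
  then obtain s where s: "s \<in> real_spectrum A" using main by blast
  obtain t where t: "t \<in> real_spectrum A" "poly (p * p - [:(norm (poly_op p A))\<^sup>2:]) t = 0"
    using main[of p] s by (cases "p * p - [:(norm (poly_op p A))\<^sup>2:] = 0") auto
  then have "(norm (poly_op p A))\<^sup>2 = (poly p t)\<^sup>2" by (simp add: power2_eq_square)
  then show ?thesis using t(1) by (metis abs_norm_cancel power2_eq_iff abs_minus_cancel)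
qed

text \<open>Uniform closeness on the spectrum thus gives closeness in operator norm. The premise on
  the sign of \<open>e\<close> covers the zero space, whose operators have empty spectrum.\<close>

lemma norm_poly_op_le:
  assumes sa: "selfadjoint A" and "e \<ge> 0" and "\<And>t. t \<in> real_spectrum A \<Longrightarrow> \<bar>poly p t\<bar> \<le> e"
  shows "norm (poly_op p A) \<le> e"
proof (cases "\<exists>z::'a. z \<noteq> 0")
  case True
  then show ?thesis using norm_poly_op_attained[OF sa] assms(3) by metis
next
  case False
  then have "poly_op p A = 0" by (intro blinfun_eqI) auto
  then show ?thesis using assms(2) by simp
qed

section \<open>Functional calculus of positive operators\<close>

definition positive_op :: "('a::real_inner \<Rightarrow>\<^sub>L 'a) \<Rightarrow> bool" where
  "positive_op A \<longleftrightarrow> selfadjoint A \<and> (\<forall>x. 0 \<le> A x \<bullet> x)"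

text \<open>Outside the interval A - t is bounded below: by - t for negative t, through the
  quadratic form, and by t - |A| for large t, through the triangle inequality.\<close>

lemma real_spectrum_positive:
  assumes "positive_op A"
  shows "real_spectrum A \<subseteq> {0..norm A}"
proof
  fix t assume t: "t \<in> real_spectrum A"
  have sa: "selfadjoint A" using assms by (simp add: positive_op_def)
  show "t \<in> {0..norm A}"
  proof (rule ccontr)
    assume "t \<notin> {0..norm A}"
    then consider "t < 0" | "t > norm A" by fastforce
    then have "\<exists>c>0. \<forall>x. c * norm x \<le> norm (op_shift A t x)"
    proof cases
      case 1
      have "- t * norm x \<le> norm (op_shift A t x)" for x
      proof (cases "x = 0")
        case False
        have "- t * (norm x * norm x) \<le> op_shift A t x \<bullet> x"
          using assms by (simp add: positive_op_def inner_diff power2_norm_eq_inner flip: power2_eq_square)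
        also have "\<dots> \<le> norm (op_shift A t x) * norm x" by (rule norm_cauchy_schwarz)
        finally have "(- t * norm x) * norm x \<le> norm (op_shift A t x) * norm x"
          by (simp only: mult.assoc)
        then show ?thesis using False by (simp only: mult_le_cancel_right) simp
      qed simp
      then show ?thesis using 1 by (intro exI[of _ "- t"]) auto
    next
      case 2
      have "(t - norm A) * norm x \<le> norm (op_shift A t x)" for x
      proof -
        have "t > 0" using 2 norm_ge_zero[of A] by linarith
        then have "t * norm x - norm (A x) \<le> norm (A x - t *\<^sub>R x)"
          using norm_triangle_ineq2[of "t *\<^sub>R x" "A x"] by (simp add: norm_minus_commute)
        then show ?thesis using norm_blinfun[of A x] by (simp add: algebra_simps)
      qed
      then show ?thesis using 2 by (intro exI[of _ "t - norm A"]) auto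
    qed
    then show False using t real_spectrum_iff[OF sa] unfolding bounded_below_def by blast
  qed
qed

lemma weierstrass_poly_sequence:
  fixes f :: "real \<Rightarrow> real"
  assumes "continuous_on {a..b} f"
  obtains p :: "nat \<Rightarrow> real poly" where "uniform_limit {a..b} (\<lambda>n. poly (p n)) f sequentially"
proof -
  have "\<exists>p. \<forall>t\<in>{a..b}. \<bar>f t - poly p t\<bar> < inverse (Suc n)" for n
  proof -
    obtain g where g: "real_polynomial_function g"
        "\<And>t. t \<in> {a..b} \<Longrightarrow> \<bar>f t - g t\<bar> < inverse (Suc n)"
      using Stone_Weierstrass_real_polynomial_function[OF compact_Icc assms, of "inverse (Suc n)"]
      by auto
    obtain c k where "g = (\<lambda>x. \<Sum>i\<le>k. c i * x ^ i)"
      using g(1) real_polynomial_function_iff_sum by blast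
    then have "g t = poly (\<Sum>i\<le>k. monom (c i) i) t" for t
      by (simp add: poly_sum poly_monom)
    then show ?thesis using g(2) by metis
  qed
  then obtain p where p: "\<And>n t. t \<in> {a..b} \<Longrightarrow> \<bar>f t - poly (p n) t\<bar> < inverse (Suc n)" by metis
  have "uniform_limit {a..b} (\<lambda>n. poly (p n)) f sequentially"
  proof (rule uniform_limitI)
    fix e :: real assume "e > 0"
    then obtain N where N: "inverse (Suc N) < e" using reals_Archimedean by blast
    have "dist (poly (p n) t) (f t) < e" if "n \<ge> N" "t \<in> {a..b}" for n t
    proof -
      have "inverse (real (Suc n)) \<le> inverse (real (Suc N))"
        using that by (intro le_imp_inverse_le) auto
      then show ?thesis using p[OF that(2), of n] N unfolding dist_real_def by linarith
    qed
    then show "\<forall>\<^sub>F n in sequentially. \<forall>t\<in>{a..b}. dist (poly (p n) t) (f t) < e"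
      unfolding eventually_sequentially by blast
  qed
  then show ?thesis using that by blast
qed

lemma poly_op_diff_tendsto_0:
  assumes sa: "selfadjoint A"
    and "uniform_limit (real_spectrum A) (\<lambda>n. poly (p n)) f sequentially"
    and "uniform_limit (real_spectrum A) (\<lambda>n. poly (q n)) f sequentially"
  shows "(\<lambda>n. poly_op (q n) A - poly_op (p n) A) \<longlonglongrightarrow> 0"
proof (rule tendstoI)
  fix e :: real assume e: "e > 0"
  have "\<forall>\<^sub>F n in sequentially. \<forall>t\<in>real_spectrum A. dist (poly (p n) t) (f t) < e / 4"
       "\<forall>\<^sub>F n in sequentially. \<forall>t\<in>real_spectrum A. dist (poly (q n) t) (f t) < e / 4"
    using assms(2,3) e by (auto dest!: uniform_limitD[where e = "e / 4"])
  then show "\<forall>\<^sub>F n in sequentially. dist (poly_op (q n) A - poly_op (p n) A) 0 < e"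
  proof eventually_elim
    case (elim n)
    have "norm (poly_op (q n - p n) A) \<le> e / 2"
    proof (rule norm_poly_op_le[OF sa])
      fix t assume "t \<in> real_spectrum A"
      then have "\<bar>poly (p n) t - f t\<bar> < e / 4" "\<bar>poly (q n) t - f t\<bar> < e / 4"
        using elim by (auto simp: dist_real_def)
      then show "\<bar>poly (q n - p n) t\<bar> \<le> e / 2" unfolding poly_diff by linarith
    qed (use e in simp)
    then show ?case using e by (simp add: poly_op_diff)
  qed
qed

lemma poly_op_Cauchy:
  assumes sa: "selfadjoint A"
    and lim: "uniform_limit (real_spectrum A) (\<lambda>n. poly (p n)) f sequentially"
  shows "Cauchy (\<lambda>n. poly_op (p n) A)"
proof (rule metric_CauchyI)
  fix e :: real assume e: "e > 0"
  obtain N where N: "\<And>n t. n \<ge> N \<Longrightarrow> t \<in> real_spectrum A \<Longrightarrow> dist (poly (p n) t) (f t) < e / 4"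
    using uniform_limitD[OF lim, of "e / 4"] e unfolding eventually_sequentially by auto
  have "dist (poly_op (p m) A) (poly_op (p n) A) < e" if "m \<ge> N" "n \<ge> N" for m n
  proof -
    have "norm (poly_op (p m - p n) A) \<le> e / 2"
    proof (rule norm_poly_op_le[OF sa])
      fix t assume "t \<in> real_spectrum A"
      then have "\<bar>poly (p m) t - f t\<bar> < e / 4" "\<bar>poly (p n) t - f t\<bar> < e / 4"
        using N that by (auto simp: dist_real_def)
      then show "\<bar>poly (p m - p n) t\<bar> \<le> e / 2" unfolding poly_diff by linarith
    qed (use e in simp)
    then show ?thesis using e by (simp add: poly_op_diff dist_norm)
  qed
  then show "\<exists>M. \<forall>m\<ge>M. \<forall>n\<ge>M. dist (poly_op (p m) A) (poly_op (p n) A) < e" by blast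
qed

text \<open>The description of \<open>cfc\<close> quantifies over all approximating sequences.
  Independence of the sequence shows that the limit \<open>B\<close> qualifies; the given sequence
  \<open>p\<close> rules out any other value.\<close>

lemma poly_op_tendsto_cfc:
  fixes A :: "'a::complex_hilbert \<Rightarrow>\<^sub>L 'a"
  assumes sa: "selfadjoint A"
    and p: "uniform_limit (real_spectrum A) (\<lambda>n. poly (p n)) f sequentially"
  shows "(\<lambda>n. poly_op (p n) A) \<longlonglongrightarrow> cfc f A"
proof -
  obtain B where B: "(\<lambda>n. poly_op (p n) A) \<longlonglongrightarrow> B"
    using poly_op_Cauchy[OF sa p] Cauchy_convergent_iff convergent_def by blast
  have all: "(\<lambda>n. poly_op (q n) A) \<longlonglongrightarrow> B"
    if "uniform_limit (real_spectrum A) (\<lambda>n. poly (q n)) f sequentially" for q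
    using tendsto_add[OF poly_op_diff_tendsto_0[OF sa p that] B] by simp
  have "cfc f A = B"
    unfolding cfc_def real_spectrum_def[symmetric]
  proof (rule the_equality)
    fix B' assume "\<forall>p. uniform_limit (real_spectrum A) (\<lambda>n. poly (p n)) f sequentially
      \<longrightarrow> (\<lambda>n. poly_op (p n) A) \<longlonglongrightarrow> B'"
    then show "B' = B" using p B LIMSEQ_unique by blast
  qed (use all in blast)
  then show ?thesis using B by simp
qed

text \<open>Approximation takes place on an interval containing the spectrum, where the Weierstrass
  theorem applies and \<open>f\<close> is bounded.\<close>

lemma cfc_approximation:
  fixes A :: "'a::complex_hilbert \<Rightarrow>\<^sub>L 'a"
  assumes pos: "positive_op A" and cont: "continuous_on {0..norm A} f"
  obtains p :: "nat \<Rightarrow> real poly" where "uniform_limit {0..norm A} (\<lambda>n. poly (p n)) f sequentially"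
    "(\<lambda>n. poly_op (p n) A) \<longlonglongrightarrow> cfc f A"
  using weierstrass_poly_sequence[OF cont] poly_op_tendsto_cfc pos[unfolded positive_op_def]
    uniform_limit_on_subset[OF _ real_spectrum_positive[OF pos]] by metis

lemma cfc_mult:
  fixes A :: "'a::complex_hilbert \<Rightarrow>\<^sub>L 'a"
  assumes pos: "positive_op A" and f: "continuous_on {0..norm A} f" and g: "continuous_on {0..norm A} g"
  shows "cfc (\<lambda>t. f t * g t) A = cfc f A o\<^sub>L cfc g A"
proof -
  obtain p where p: "uniform_limit {0..norm A} (\<lambda>n. poly (p n)) f sequentially"
    "(\<lambda>n. poly_op (p n) A) \<longlonglongrightarrow> cfc f A" using cfc_approximation[OF pos f] .
  obtain q where q: "uniform_limit {0..norm A} (\<lambda>n. poly (q n)) g sequentially"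
    "(\<lambda>n. poly_op (q n) A) \<longlonglongrightarrow> cfc g A" using cfc_approximation[OF pos g] .
  \<comment> \<open>Uniform convergence of products relies on bounded limit functions, supplied by
    compactness of the interval.\<close>
  have "uniform_limit {0..norm A} (\<lambda>n t. poly (p n) t * poly (q n) t) (\<lambda>t. f t * g t) sequentially"
    by (intro uniform_lim_mult p(1) q(1) compact_imp_bounded compact_continuous_image f g compact_Icc)
  then have "uniform_limit {0..norm A} (\<lambda>n. poly (p n * q n)) (\<lambda>t. f t * g t) sequentially"
    by (simp add: poly_mult[abs_def] cong: uniform_limit_cong')
  then have "(\<lambda>n. poly_op (p n * q n) A) \<longlonglongrightarrow> cfc (\<lambda>t. f t * g t) A"
    using poly_op_tendsto_cfc pos[unfolded positive_op_def]
      uniform_limit_on_subset[OF _ real_spectrum_positive[OF pos]] by metis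
  moreover have "(\<lambda>n. poly_op (p n * q n) A) \<longlonglongrightarrow> (cfc f A o\<^sub>L cfc g A)"
    unfolding poly_op_mult
    by (rule bounded_bilinear.tendsto[OF bounded_bilinear_blinfun_compose p(2) q(2)])
  ultimately show ?thesis by (rule LIMSEQ_unique)
qed

lemma blinfun_apply_tendsto:
  assumes "X \<longlonglongrightarrow> B"
  shows "(\<lambda>n. blinfun_apply (X n) x) \<longlonglongrightarrow> B x"
  by (rule bounded_bilinear.tendsto[OF bounded_bilinear_blinfun_apply assms tendsto_const])

lemma selfadjoint_cfc:
  fixes A :: "'a::complex_hilbert \<Rightarrow>\<^sub>L 'a"
  assumes pos: "positive_op A" and f: "continuous_on {0..norm A} f"
  shows "selfadjoint (cfc f A)"
  unfolding selfadjoint_def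
proof (intro allI)
  fix x y
  obtain p where p: "(\<lambda>n. poly_op (p n) A) \<longlonglongrightarrow> cfc f A" using cfc_approximation[OF pos f] .
  have eq: "poly_op (p n) A x \<bullet> y = x \<bullet> poly_op (p n) A y" for n
    using selfadjoint_poly_op pos unfolding positive_op_def selfadjoint_def by blast
  have "(\<lambda>n. poly_op (p n) A x \<bullet> y) \<longlonglongrightarrow> cfc f A x \<bullet> y"
    by (intro tendsto_intros blinfun_apply_tendsto p)
  moreover have "(\<lambda>n. poly_op (p n) A x \<bullet> y) \<longlonglongrightarrow> x \<bullet> cfc f A y"
    unfolding eq by (intro tendsto_intros blinfun_apply_tendsto p)
  ultimately show "cfc f A x \<bullet> y = x \<bullet> cfc f A y" by (rule LIMSEQ_unique)
qed

lemma bounded_linear_scaleC: "bounded_linear (\<lambda>x::'a::complex_normed_vector. c *\<^sub>C x)"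
proof (rule bounded_linear_intro[where K = "cmod c"])
  show "c *\<^sub>C r *\<^sub>R x = r *\<^sub>R c *\<^sub>C x" for r and x :: 'a
    by (metis scaleC_of_real scaleC_scaleC mult.commute)
qed (simp_all add: scaleC_add_right norm_scaleC mult.commute)

lemma complex_linear_cfc:
  fixes A :: "'a::complex_hilbert \<Rightarrow>\<^sub>L 'a"
  assumes pos: "positive_op A" and f: "continuous_on {0..norm A} f" and lin: "complex_linear A"
  shows "complex_linear (cfc f A)"
  unfolding complex_linear_def
proof (intro allI)
  fix c x
  obtain p where p: "(\<lambda>n. poly_op (p n) A) \<longlonglongrightarrow> cfc f A" using cfc_approximation[OF pos f] .
  have eq: "poly_op (p n) A (c *\<^sub>C x) = c *\<^sub>C poly_op (p n) A x" for n
    using complex_linear_poly_op[OF lin] unfolding complex_linear_def by blast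
  have "(\<lambda>n. poly_op (p n) A (c *\<^sub>C x)) \<longlonglongrightarrow> cfc f A (c *\<^sub>C x)"
    by (intro blinfun_apply_tendsto p)
  moreover have "(\<lambda>n. poly_op (p n) A (c *\<^sub>C x)) \<longlonglongrightarrow> c *\<^sub>C cfc f A x"
    unfolding eq by (intro bounded_linear.tendsto[OF bounded_linear_scaleC] blinfun_apply_tendsto p)
  ultimately show "cfc f A (c *\<^sub>C x) = c *\<^sub>C cfc f A x" by (rule LIMSEQ_unique)
qed

section \<open>Powers of a positive operator\<close>

lemma continuous_on_powr_nonneg: "r > 0 \<Longrightarrow> continuous_on {0..b::real} (\<lambda>t. t powr r)"
  by (intro continuous_on_powr' continuous_intros) auto

text \<open>Positive exponents keep \<open>t powr r\<close> continuous at 0; for exponent 0 the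
  convention \<open>0 powr 0 = 0\<close> would break this.\<close>

lemma op_powr_add:
  assumes "positive_op A" "r > 0" "s > 0"
  shows "op_powr A (r + s) = op_powr A r o\<^sub>L op_powr A s"
  unfolding op_powr_def
  using cfc_mult[OF assms(1) continuous_on_powr_nonneg[OF assms(2)] continuous_on_powr_nonneg[OF assms(3)]]
  by (simp add: powr_add)

lemma op_powr_1:
  assumes "positive_op A"
  shows "op_powr A 1 = A"
proof -
  have A: "poly_op [:0, 1:] A = A" using poly_op_linear[of 0 A] by (simp add: op_shift_def)
  have "uniform_limit (real_spectrum A) (\<lambda>n::nat. poly [:0, 1:]) (\<lambda>t. t powr 1) sequentially"
    using real_spectrum_positive[OF assms] by (intro uniform_limitI) auto
  then have "(\<lambda>n::nat. poly_op [:0, 1:] A) \<longlonglongrightarrow> op_powr A 1"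
    unfolding op_powr_def
    using assms by (intro poly_op_tendsto_cfc) (auto simp: positive_op_def)
  then show ?thesis unfolding A using LIMSEQ_unique tendsto_const by blast
qed

lemma selfadjoint_op_powr: "positive_op A \<Longrightarrow> r > 0 \<Longrightarrow> selfadjoint (op_powr A r)"
  unfolding op_powr_def by (intro selfadjoint_cfc continuous_on_powr_nonneg)

lemma complex_linear_op_powr:
  "positive_op A \<Longrightarrow> complex_linear A \<Longrightarrow> r > 0 \<Longrightarrow> complex_linear (op_powr A r)"
  unfolding op_powr_def by (intro complex_linear_cfc continuous_on_powr_nonneg)

text \<open>The power is the square of the self-adjoint operator
  \<open>op_powr A (r / 2)\<close>.\<close>

lemma positive_op_powr:
  assumes "positive_op A" "r > 0"
  shows "positive_op (op_powr A r)"
proof -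
  let ?R = "op_powr A (r / 2)"
  have sa: "selfadjoint ?R" using assms by (simp add: selfadjoint_op_powr)
  have "op_powr A r = ?R o\<^sub>L ?R"
    using op_powr_add[of A "r / 2" "r / 2"] assms by simp
  then have "op_powr A r x \<bullet> x = ?R x \<bullet> ?R x" for x
    using sa by (simp add: selfadjoint_def)
  then show ?thesis using assms by (simp add: positive_op_def selfadjoint_op_powr)
qed

lemma bounded_below_op_powr_iff:
  assumes pos: "positive_op A" and l: "0 < l" "l < 1"
  shows "bounded_below (op_powr A l) \<longleftrightarrow> bounded_below A"
proof
  assume "bounded_below A"
  moreover have "A = op_powr A (1 - l) o\<^sub>L op_powr A l"
    using op_powr_add[of A "1 - l" l] op_powr_1[OF pos] assms by simp
  ultimately show "bounded_below (op_powr A l)" using bounded_below_right_factor by metis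
next
  assume bb: "bounded_below (op_powr A l)"
  have mult: "bounded_below (op_powr A (real (Suc n) * l))" for n
  proof (induction n)
    case (Suc n)
    have "op_powr A (real (Suc (Suc n)) * l) = op_powr A l o\<^sub>L op_powr A (real (Suc n) * l)"
    proof -
      have "real (Suc (Suc n)) * l = l + real (Suc n) * l" by (simp add: distrib_right)
      moreover have "real (Suc n) * l > 0" using l(1) by (intro mult_pos_pos) auto
      ultimately show ?thesis using op_powr_add[OF pos l(1)] by metis
    qed
    then show ?case using bounded_below_compose[OF bb Suc.IH] by simp
  qed (use bb in simp)
  \<comment> \<open>The inequality has to be strict, so that the exponent left after splitting off
    \<open>A\<close> is positive.\<close>
  obtain n where "1 / l < real n" using reals_Archimedean2 by blast
  then have n: "1 < real (Suc n) * l" using l by (simp add: field_simps)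
  then have "op_powr A (real (Suc n) * l) = op_powr A (real (Suc n) * l - 1) o\<^sub>L A"
    using op_powr_add[of A "real (Suc n) * l - 1" 1] op_powr_1[OF pos] pos by simp
  then show "bounded_below A" using bounded_below_right_factor mult[of n] by metis
qed

section \<open>Adjoint and polar decomposition\<close>

lemma cinner_i_scaleC_right: "cinner x (\<i> *\<^sub>C y) = - \<i> * cinner x y"
  by (metis cinner_commute cinner_scaleC_left complex_cnj_mult complex_cnj_i)

text \<open>Rotating the second argument by i recovers the imaginary part, so identities for
  \<open>cinner\<close> reduce to the real inner product.\<close>

lemma cinner_eq_inner:
  "cinner x y = Complex (x \<bullet> y) (x \<bullet> (\<i> *\<^sub>C y))" for x y :: "'a::complex_inner"
  by (simp add: inner_eq_Re_cinner cinner_i_scaleC_right complex_eq_iff)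

lemma inner_i_scaleC:
  "(\<i> *\<^sub>C x) \<bullet> y = - (x \<bullet> (\<i> *\<^sub>C y))" for x y :: "'a::complex_inner"
  by (simp add: inner_eq_Re_cinner cinner_i_scaleC_right cinner_scaleC_left)

lemma complex_linearI:
  fixes T :: "'a::complex_normed_vector \<Rightarrow>\<^sub>L 'a"
  assumes "\<And>x. T (\<i> *\<^sub>C x) = \<i> *\<^sub>C T x"
  shows "complex_linear T"
  unfolding complex_linear_def
proof (intro allI)
  fix c x
  have "c *\<^sub>C y = Re c *\<^sub>R y + Im c *\<^sub>R (\<i> *\<^sub>C y)" for y :: 'a
  proof -
    have "c = of_real (Re c) + of_real (Im c) * \<i>" by (simp add: complex_eq_iff)
    then show ?thesis by (metis scaleC_add_left scaleC_of_real scaleC_scaleC)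
  qed
  then show "T (c *\<^sub>C x) = c *\<^sub>C T x"
    by (simp add: blinfun.bilinear_simps assms)
qed

text \<open>The real adjoint is already the complex one: \<open>T\<close> commutes with i, and
  multiplication by i is skew for the real inner product, so the adjoint commutes with i
  too.\<close>

lemma cadjoint:
  fixes T :: "'a::complex_hilbert \<Rightarrow>\<^sub>L 'a"
  assumes lin: "complex_linear T"
  shows inner_cadjoint: "T x \<bullet> y = x \<bullet> cadjoint T y"
    and complex_linear_cadjoint: "complex_linear (cadjoint T)"
proof -
  obtain S :: "'a \<Rightarrow>\<^sub>L 'a" where S: "\<And>x y. T x \<bullet> y = x \<bullet> S y"
    using real_adjoint_exists[of T] by blast
  have Ti: "T (\<i> *\<^sub>C x) = \<i> *\<^sub>C T x" for x using lin by (simp add: complex_linear_def)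
  have Si: "S (\<i> *\<^sub>C y) = \<i> *\<^sub>C S y" for y
  proof (rule vector_eq_ldot[THEN iffD1], intro allI)
    fix x
    have "x \<bullet> S (\<i> *\<^sub>C y) = - (T (\<i> *\<^sub>C x) \<bullet> y)" by (simp add: Ti inner_i_scaleC flip: S)
    also have "\<dots> = x \<bullet> (\<i> *\<^sub>C S y)" by (simp add: inner_i_scaleC S)
    finally show "x \<bullet> S (\<i> *\<^sub>C y) = x \<bullet> (\<i> *\<^sub>C S y)" .
  qed
  have "cadjoint T = S"
    unfolding cadjoint_def
  proof (rule the_equality)
    show "\<forall>x y. cinner (T x) y = cinner x (S y)"
      by (simp add: cinner_eq_inner S Si)
    fix S' :: "'a \<Rightarrow>\<^sub>L 'a" assume "\<forall>x y. cinner (T x) y = cinner x (S' y)"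
    then have "x \<bullet> S' y = x \<bullet> S y" for x y
      by (metis S inner_eq_Re_cinner)
    then show "S' = S" by (intro blinfun_eqI vector_eq_ldot[THEN iffD1]) simp
  qed
  then show "T x \<bullet> y = x \<bullet> cadjoint T y" "complex_linear (cadjoint T)"
    using S Si by (auto intro: complex_linearI)
qed

lemma complex_linear_compose:
  "complex_linear S \<Longrightarrow> complex_linear T \<Longrightarrow> complex_linear (S o\<^sub>L T)"
  by (simp add: complex_linear_def)

section \<open>Absolute value, polar isometry and Aluthge transform\<close>

context
  fixes T :: "'a::complex_hilbert \<Rightarrow>\<^sub>L 'a"
  assumes lin: "complex_linear T"
begin

lemma positive_cadjoint_compose: "positive_op (cadjoint T o\<^sub>L T)"
proof -
  have "cadjoint T (T x) \<bullet> y = T x \<bullet> T y" for x y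
    by (metis inner_cadjoint[OF lin] inner_commute)
  then show ?thesis by (simp add: positive_op_def selfadjoint_def flip: inner_cadjoint[OF lin])
qed

lemma positive_abs_op: "positive_op (abs_op T)"
  unfolding abs_op_def by (simp add: positive_op_powr positive_cadjoint_compose)

lemma complex_linear_abs_op: "complex_linear (abs_op T)"
  unfolding abs_op_def
  by (intro complex_linear_op_powr positive_cadjoint_compose complex_linear_compose
      complex_linear_cadjoint lin) simp

text \<open>Both squares equal the quadratic form of T* T at x. This carries lower bounds and
  kernels between \<open>T\<close> and \<open>abs_op T\<close>.\<close>

lemma norm_abs_op: "norm (abs_op T x) = norm (T x)"
proof -
  let ?A = "cadjoint T o\<^sub>L T"
  have "op_powr ?A (1/2 + 1/2) = op_powr ?A (1/2) o\<^sub>L op_powr ?A (1/2)"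
    by (rule op_powr_add[OF positive_cadjoint_compose]) simp_all
  also have "op_powr ?A (1/2 + 1/2) = ?A"
    using op_powr_1[OF positive_cadjoint_compose] by simp
  finally have "abs_op T o\<^sub>L abs_op T = ?A"
    by (simp add: abs_op_def)
  then have sq: "abs_op T (abs_op T x) = cadjoint T (T x)"
    by (metis blinfun_apply_blinfun_compose)
  have "abs_op T x \<bullet> abs_op T x = x \<bullet> abs_op T (abs_op T x)"
    using positive_abs_op unfolding positive_op_def selfadjoint_def by blast
  also have "\<dots> = T x \<bullet> T x"
    unfolding sq by (rule inner_cadjoint[OF lin, symmetric])
  finally show ?thesis by (simp add: norm_eq_sqrt_inner)
qed

lemma bounded_below_abs_op_iff: "bounded_below (abs_op T) \<longleftrightarrow> bounded_below T"
  by (simp add: bounded_below_def norm_abs_op)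

text \<open>
  If \<open>|T|\<close> is invertible then \<open>T |T|\<^sup>-\<^sup>1\<close> is the only operator \<open>U\<close> with \<open>T = U |T|\<close>, and
  \<open>\<Delta>\<^sub>l(T) = |T|\<^sup>l T |T|\<^sup>-\<^sup>l\<close> because \<open>|T| = |T|\<^sup>1\<^sup>-\<^sup>l |T|\<^sup>l\<close>.
\<close>

lemma polar_isometry_compose_abs_op:
  assumes bb: "bounded_below T"
  shows "polar_isometry T o\<^sub>L abs_op T = T"
proof -
  have bba: "bounded_below (abs_op T)" using bb by (simp add: bounded_below_abs_op_iff)
  then have bij: "bij (blinfun_apply (abs_op T))"
    using positive_abs_op by (intro selfadjoint_bounded_below_bij) (auto simp: positive_op_def)
  obtain R where R: "R o\<^sub>L abs_op T = id_blinfun" "abs_op T o\<^sub>L R = id_blinfun"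
    using bounded_below_bij_inverse[OF bba bij] .
  have Rl: "R (abs_op T x) = x" and Rr: "abs_op T (R x) = x" for x
    using R by (metis blinfun_apply_blinfun_compose blinfun_apply_id_blinfun)+
  define U where "U = T o\<^sub>L R"
  have Ux: "norm (U x) = norm x" for x
    using norm_abs_op[of "R x"] by (simp add: U_def Rr)
  have "R (c *\<^sub>C x) = c *\<^sub>C R x" for c x
    using complex_linear_abs_op unfolding complex_linear_def by (metis Rl Rr)
  then have "complex_linear U"
    using lin by (simp add: complex_linear_def U_def)
  then have "partial_isometry U" using Ux by (simp add: partial_isometry_def)
  moreover have fac: "T = U o\<^sub>L abs_op T"
    by (rule blinfun_eqI) (simp add: U_def Rl)
  moreover have "ker_op U = ker_op T" "ker_op T = ker_op (abs_op T)"
  proof -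
    have "U x = 0 \<longleftrightarrow> x = 0" for x using Ux by (metis norm_eq_zero)
    moreover have "abs_op T x = 0 \<longleftrightarrow> x = 0" for x by (metis Rl blinfun.zero_right)
    moreover have "T x = 0 \<longleftrightarrow> abs_op T x = 0" for x by (metis norm_abs_op norm_eq_zero)
    ultimately show "ker_op U = ker_op T" "ker_op T = ker_op (abs_op T)"
      by (auto simp: ker_op_def)
  qed
  moreover have "V = U" if "T = V o\<^sub>L abs_op T" for V
  proof (rule blinfun_eqI)
    fix x
    have "V (abs_op T (R x)) = U (abs_op T (R x))"
      using that fac by (metis blinfun_apply_blinfun_compose)
    then show "V x = U x" by (simp add: Rr)
  qed
  ultimately have "polar_isometry T = U"
    unfolding polar_isometry_def by (intro the_equality) blast+
  then show ?thesis using fac by simp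
qed

lemma lambda_aluthge_similar:
  assumes bb: "bounded_below T" and l: "0 < l" "l < 1"
  obtains P R where "complex_linear P" "complex_linear R" "R o\<^sub>L P = id_blinfun" "P o\<^sub>L R = id_blinfun"
    "lambda_aluthge l T = P o\<^sub>L T o\<^sub>L R"
proof -
  define P where "P = op_powr (abs_op T) l"
  have pos: "positive_op P" unfolding P_def using positive_abs_op l(1) by (rule positive_op_powr)
  have bbP: "bounded_below P"
    using bb by (simp add: P_def bounded_below_op_powr_iff[OF positive_abs_op l] bounded_below_abs_op_iff)
  then have "bij (blinfun_apply P)"
    using pos by (intro selfadjoint_bounded_below_bij) (auto simp: positive_op_def)
  then obtain R where R: "R o\<^sub>L P = id_blinfun" "P o\<^sub>L R = id_blinfun"
    using bounded_below_bij_inverse[OF bbP] by metis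
  have Rl: "R (P x) = x" and Rr: "P (R x) = x" for x
    using R by (metis blinfun_apply_blinfun_compose blinfun_apply_id_blinfun)+
  have P: "complex_linear P"
    unfolding P_def by (intro complex_linear_op_powr positive_abs_op complex_linear_abs_op l)
  then have "complex_linear R" unfolding complex_linear_def by (metis Rl Rr)
  moreover have fac: "abs_op T = op_powr (abs_op T) (1 - l) o\<^sub>L P"
    using op_powr_add[OF positive_abs_op, of "1 - l" l] op_powr_1[OF positive_abs_op] l
    by (simp add: P_def)
  moreover have "lambda_aluthge l T = P o\<^sub>L T o\<^sub>L R"
  proof (rule blinfun_eqI)
    fix x
    \<comment> \<open>Multiplying |T| = |T|^(1-l) P by R on the right gives |T|^(1-l) = |T| R, hence
      U |T|^(1-l) = U |T| R = T R.\<close>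
    have "abs_op T (R x) = op_powr (abs_op T) (1 - l) (P (R x))"
      using fac by (metis blinfun_apply_blinfun_compose)
    then have "op_powr (abs_op T) (1 - l) x = abs_op T (R x)" by (simp add: Rr)
    moreover have "polar_isometry T (abs_op T (R x)) = T (R x)"
      using polar_isometry_compose_abs_op[OF bb] by (metis blinfun_apply_blinfun_compose)
    ultimately show "lambda_aluthge l T x = (P o\<^sub>L T o\<^sub>L R) x"
      by (simp add: lambda_aluthge_def P_def)
  qed
  ultimately show ?thesis using that P R by blast
qed

text \<open>
  A self-adjoint operator \<open>P\<close> with a bounded right inverse \<open>R\<close> is bounded below:
  \<open>\<parallel>x\<parallel>\<^sup>2 = \<langle>x, P R x\<rangle> = \<langle>P x, R x\<rangle>\<close>.
\<close>

lemma bounded_below_if_lambda_aluthge_invertible: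
  assumes inv: "boundedly_invertible_on UNIV (lambda_aluthge l T)" and l: "0 < l" "l < 1"
  shows "bounded_below T"
proof -
  define P where "P = op_powr (abs_op T) l"
  \<comment> \<open>Only the boundedness of \<open>Q\<close> enters below, whatever operator
    \<open>polar_isometry T\<close> denotes.\<close>
  define Q where "Q = polar_isometry T o\<^sub>L op_powr (abs_op T) (1 - l)"
  have D: "lambda_aluthge l T x = P (Q x)" for x
    by (simp add: lambda_aluthge_def P_def Q_def)
  obtain K where K: "\<And>y. norm (inv (lambda_aluthge l T) y) \<le> K * norm y"
    and surj: "surj (lambda_aluthge l T)"
    using inv unfolding boundedly_invertible_on_def bij_def by blast
  define R where "R = (\<lambda>y. Q (inv (lambda_aluthge l T) y))"
  have PR: "P (R y) = y" for y
    using surj_f_inv_f[OF surj, of y] by (simp add: R_def D)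
  define C where "C = norm Q * \<bar>K\<bar> + 1"
  have C: "C > 0" by (simp add: C_def add_nonneg_pos)
  have R: "norm (R y) \<le> C * norm y" for y
  proof -
    have "norm (R y) \<le> norm Q * norm (inv (lambda_aluthge l T) y)"
      unfolding R_def by (rule norm_blinfun)
    also have "\<dots> \<le> norm Q * (\<bar>K\<bar> * norm y)"
      by (intro mult_left_mono order_trans[OF K] mult_right_mono) auto
    also have "\<dots> \<le> C * norm y" by (simp add: C_def algebra_simps)
    finally show ?thesis .
  qed
  have "1 / C * norm x \<le> norm (P x)" for x
  proof (cases "x = 0")
    case False
    have "norm x * norm x = x \<bullet> P (R x)"
      by (simp add: PR power2_norm_eq_inner flip: power2_eq_square)
    also have "\<dots> = P x \<bullet> R x"
      using selfadjoint_op_powr[OF positive_abs_op l(1)] by (simp add: P_def selfadjoint_def)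
    also have "\<dots> \<le> norm (P x) * norm (R x)" by (rule norm_cauchy_schwarz)
    also have "\<dots> \<le> norm (P x) * (C * norm x)" by (intro mult_left_mono R) simp
    finally have "norm x \<le> norm (P x) * C" using False by (simp flip: mult.assoc)
    then show ?thesis using C by (simp add: pos_divide_le_eq)
  qed simp
  moreover have "1 / C > 0" using C by simp
  ultimately have "bounded_below P" unfolding bounded_below_def by blast
  then show ?thesis
    by (simp add: P_def bounded_below_op_powr_iff[OF positive_abs_op l] bounded_below_abs_op_iff)
qed

end

section \<open>Similarity\<close>

text \<open>Here \<open>f\<close> is a bare function, so that it may also stand for a shifted
  restriction or be built from \<open>inv T\<close>.\<close>

lemma boundedly_invertible_on_conj:
  fixes P R :: "'a::complex_normed_vector \<Rightarrow>\<^sub>L 'a"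
  assumes RP: "\<And>x. R (P x) = x" and inv: "boundedly_invertible_on M f"
  shows "boundedly_invertible_on (P ` M) (\<lambda>x. P (f (R x)))"
proof -
  obtain K where bij: "bij_betw f M M" and K: "\<And>y. y \<in> M \<Longrightarrow> norm (inv_into M f y) \<le> K * norm y"
    using inv unfolding boundedly_invertible_on_def by blast
  let ?g = "\<lambda>x. P (f (R x))"
  have bij': "bij_betw ?g (P ` M) (P ` M)"
  proof (rule bij_betw_byWitness[where f' = "\<lambda>x. P (inv_into M f (R x))"])
    show "\<forall>a\<in>P ` M. P (inv_into M f (R (P (f (R a))))) = a"
      using bij by (auto simp: RP bij_betw_def)
    show "\<forall>a\<in>P ` M. P (f (R (P (inv_into M f (R a))))) = a"
      using bij by (auto simp: RP bij_betw_inv_into_right)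
    show "?g ` P ` M \<subseteq> P ` M"
      using bij by (auto simp: RP bij_betw_def)
    show "(\<lambda>x. P (inv_into M f (R x))) ` P ` M \<subseteq> P ` M"
      using bij by (auto simp: RP bij_betw_def inv_into_into)
  qed
  have "norm (inv_into (P ` M) ?g y) \<le> (norm P * \<bar>K\<bar> * norm R) * norm y" if "y \<in> P ` M" for y
  proof -
    obtain m where m: "m \<in> M" "y = P m" using \<open>y \<in> P ` M\<close> by blast
    have mm: "inv_into M f m \<in> M" "f (inv_into M f m) = m"
      using bij m(1) by (auto simp: bij_betw_def inv_into_into f_inv_into_f)
    have "inv_into (P ` M) ?g y = P (inv_into M f m)"
      using bij' mm m by (intro inv_into_f_eq) (auto simp: bij_betw_def RP)
    then have "norm (inv_into (P ` M) ?g y) \<le> norm P * norm (inv_into M f m)"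
      using norm_blinfun[of P] by simp
    also have "\<dots> \<le> norm P * (\<bar>K\<bar> * norm m)"
      by (intro mult_left_mono order_trans[OF K[OF m(1)]] mult_right_mono) auto
    also have "\<dots> \<le> norm P * (\<bar>K\<bar> * (norm R * norm y))"
      using norm_blinfun[of R y] by (intro mult_left_mono) (auto simp: m RP)
    finally show ?thesis by (simp add: mult.assoc)
  qed
  then show ?thesis using bij' unfolding boundedly_invertible_on_def by blast
qed

lemma spectrum_on_conj_subset:
  fixes P R :: "'a::complex_normed_vector \<Rightarrow>\<^sub>L 'a"
  assumes RP: "\<And>x. R (P x) = x" and PR: "\<And>x. P (R x) = x" and P: "complex_linear P"
  shows "spectrum_on (P ` M) (\<lambda>x. P (f (R x))) \<subseteq> spectrum_on M f"
proof -
  have "boundedly_invertible_on (P ` M) (\<lambda>x. P (f (R x)) - z *\<^sub>C x)"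
    if "boundedly_invertible_on M (\<lambda>x. f x - z *\<^sub>C x)" for z
    using boundedly_invertible_on_conj[of R P, OF RP that] P
    by (simp add: blinfun.diff_right complex_linear_def PR)
  then show ?thesis by (auto simp: spectrum_on_def)
qed

lemma spectral_radius_on_conj:
  fixes P R :: "'a::complex_normed_vector \<Rightarrow>\<^sub>L 'a"
  assumes RP: "\<And>x. R (P x) = x" and PR: "\<And>x. P (R x) = x"
    and P: "complex_linear P" and R: "complex_linear R"
  shows "spectral_radius_on (P ` M) (\<lambda>x. P (f (R x))) = spectral_radius_on M f"
proof -
  \<comment> \<open>The roles of \<open>P\<close> and \<open>R\<close> are exchanged: conjugating
    back restores \<open>M\<close> and \<open>f\<close>.\<close>
  have "spectrum_on M f \<subseteq> spectrum_on (P ` M) (\<lambda>x. P (f (R x)))"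
    using spectrum_on_conj_subset[of P R "P ` M" "\<lambda>x. P (f (R x))", OF PR RP R]
    by (simp add: RP image_image)
  then have "spectrum_on (P ` M) (\<lambda>x. P (f (R x))) = spectrum_on M f"
    using spectrum_on_conj_subset[of R P M f, OF RP PR P] by blast
  then show ?thesis by (simp add: spectral_radius_on_def)
qed

lemma closed_csubspace_image:
  fixes P R :: "'a::complex_normed_vector \<Rightarrow>\<^sub>L 'a"
  assumes RP: "\<And>x. R (P x) = x" and PR: "\<And>x. P (R x) = x" and P: "complex_linear P"
    and M: "closed_csubspace M"
  shows "closed_csubspace (P ` M)"
proof -
  \<comment> \<open>As a preimage under the continuous \<open>R\<close>, the image is
    closed.\<close>
  have eq: "P ` M = blinfun_apply R -` M" by (auto simp: RP image_iff) (metis PR)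
  have "closed (P ` M)"
    unfolding eq using M
    by (intro closed_vimage) (auto simp: closed_csubspace_def intro: continuous_intros)
  moreover have "subspace (P ` M)"
    using M by (intro linear_subspace_image blinfun.bounded_linear_right[THEN bounded_linear.linear])
      (auto simp: closed_csubspace_def)
  moreover have "c *\<^sub>C P x \<in> P ` M" if "x \<in> M" for c x
    using M P that unfolding closed_csubspace_def complex_linear_def by (metis image_eqI)
  ultimately show ?thesis by (auto simp: closed_csubspace_def)
qed

lemma generalized_hyperbolic_conj:
  fixes P R T :: "'a::complex_banach \<Rightarrow>\<^sub>L 'a"
  assumes RP: "R o\<^sub>L P = id_blinfun" and PR: "P o\<^sub>L R = id_blinfun"
    and P: "complex_linear P" and R: "complex_linear R"
    and gh: "generalized_hyperbolic T"
  shows "generalized_hyperbolic (P o\<^sub>L T o\<^sub>L R)"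
proof -
  have rp: "R (P x) = x" and pr: "P (R x) = x" for x
    using RP PR by (metis blinfun_apply_blinfun_compose blinfun_apply_id_blinfun)+
  let ?T = "P o\<^sub>L T o\<^sub>L R"
  have T: "blinfun_apply ?T = (\<lambda>x. P (T (R x)))" by (simp add: fun_eq_iff)
  have surjP: "range (blinfun_apply P) = UNIV" using pr by (metis surjI)
  obtain M N where inv: "boundedly_invertible_on UNIV T"
    and M: "closed_csubspace M" and N: "closed_csubspace N"
    and int: "M \<inter> N = {0}" and sum: "\<And>x. \<exists>m\<in>M. \<exists>n\<in>N. x = m + n"
    and TM: "T ` M \<subseteq> M" and TN: "inv T ` N \<subseteq> N"
    and rad: "spectral_radius_on M T < 1" "spectral_radius_on N (inv T) < 1"
    using gh unfolding generalized_hyperbolic_def by blast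
  have inv': "boundedly_invertible_on UNIV ?T"
    using boundedly_invertible_on_conj[of R P, OF rp inv] unfolding T surjP .
  have bij: "bij T" "bij ?T" using inv inv' by (auto simp: boundedly_invertible_on_def)
  have invT: "inv ?T = (\<lambda>x. P (inv T (R x)))"
    using bij(1) by (intro inv_unique_comp) (auto simp: fun_eq_iff rp pr bij_is_inj surj_f_inv_f bij_is_surj)
  have "P ` M \<inter> P ` N = {0}"
  proof -
    have "inj (blinfun_apply P)" using rp by (metis injI)
    then have "P ` M \<inter> P ` N = P ` (M \<inter> N)" by (simp add: image_Int)
    then show ?thesis by (simp add: int blinfun.zero_right)
  qed
  moreover have "\<exists>m\<in>P ` M. \<exists>n\<in>P ` N. x = m + n" for x
  proof -
    obtain m n where mn: "m \<in> M" "n \<in> N" "R x = m + n" using sum by blast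
    then have "x = P m + P n" by (metis pr blinfun.add_right)
    then show ?thesis using mn by blast
  qed
  moreover have "?T ` P ` M \<subseteq> P ` M" using TM by (auto simp: rp)
  moreover have "inv ?T ` P ` N \<subseteq> P ` N" unfolding invT using TN by (auto simp: rp)
  moreover have "spectral_radius_on (P ` M) ?T < 1" "spectral_radius_on (P ` N) (inv ?T) < 1"
    unfolding invT unfolding T using rad by (simp_all only: spectral_radius_on_conj[OF rp pr P R])
  ultimately show ?thesis
    using inv' closed_csubspace_image[OF rp pr P M] closed_csubspace_image[OF rp pr P N]
    unfolding generalized_hyperbolic_def by blast
qed

lemma generalized_hyperbolic_lambda_aluthge_iff:
  fixes T :: "'a::complex_hilbert \<Rightarrow>\<^sub>L 'a"
  assumes lin: "complex_linear T" and l: "0 < l" "l < 1"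
  shows "generalized_hyperbolic T \<longleftrightarrow> generalized_hyperbolic (lambda_aluthge l T)"
proof (cases "bounded_below T")
  case True
  obtain P R where PR: "complex_linear P" "complex_linear R" "R o\<^sub>L P = id_blinfun" "P o\<^sub>L R = id_blinfun"
    and D: "lambda_aluthge l T = P o\<^sub>L T o\<^sub>L R"
    using lambda_aluthge_similar[OF lin True l] .
  have "R (P x) = x" for x
    using PR(3) by (metis blinfun_apply_blinfun_compose blinfun_apply_id_blinfun)
  then have T: "T = R o\<^sub>L lambda_aluthge l T o\<^sub>L P"
    by (intro blinfun_eqI) (simp add: D)
  show ?thesis
  proof
    assume "generalized_hyperbolic T"
    then show "generalized_hyperbolic (lambda_aluthge l T)"
      unfolding D by (rule generalized_hyperbolic_conj[OF PR(3,4,1,2)])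
  next
    assume "generalized_hyperbolic (lambda_aluthge l T)"
    then show "generalized_hyperbolic T"
      by (subst T) (rule generalized_hyperbolic_conj[OF PR(4,3,2,1)])
  qed
next
  case False
  \<comment> \<open>Neither operator is invertible, so both sides of the equivalence are
    false.\<close>
  then have "\<not> boundedly_invertible_on UNIV T"
    using bounded_below_of_boundedly_invertible by blast
  moreover have "\<not> boundedly_invertible_on UNIV (lambda_aluthge l T)"
    using False bounded_below_if_lambda_aluthge_invertible[OF lin _ l] by blast
  ultimately show ?thesis by (simp add: generalized_hyperbolic_def)
qed

theorem theorem2p5:
  fixes T :: "'a::complex_hilbert \<Rightarrow>\<^sub>L 'a" and l :: real
  assumes "complex_linear T" and "0 < l" and "l < 1"
  shows "(generalized_hyperbolic T \<longleftrightarrow> generalized_hyperbolic (lambda_aluthge l T)) \<and>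
         (generalized_hyperbolic T \<longleftrightarrow> generalized_hyperbolic (aluthge T))"
  using generalized_hyperbolic_lambda_aluthge_iff[OF assms]
    generalized_hyperbolic_lambda_aluthge_iff[OF assms(1), of "1/2"]
  by (simp add: aluthge_eq_lambda_aluthge)

end
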